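(* Let $G$ be an equitably 4-colorable graph on $n\ge 2$ vertices and let $k\ge 3$, $l\ge 1$ be integers. If $3$ does not divide $n$, then $\chi_{=}(G\circ^l C_{2k})=4$.
   Context: All graphs are finite, simple and connected. $C_m$ denotes the cycle on $m$ vertices. A graph is equitably $k$-colorable if its vertex set can be partitioned into $k$ (possibly empty) independent sets $V_1,\dots,V_k$ with $||V_i|-|V_j||\le 1$ for all $i,j$; $\chi_{=}(G)$ is the least $k$ for which $G$ is equitably $k$-colorable. The corona $G\circ H$ is formed from one copy of $G$ and $|V(G)|$ copies of $H$, the $i$-th vertex of $G$ being joined to every vertex of the $i$-th copy of $H$; $G\circ^1 H=G\circ H$ and $G\circ^l H=(G\circ^{l-1}H)\circ H$ for $l\ge 2$. *)

theory Defs
  imports "Graph_Theory.Graph_Theory"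
begin

definition independent_set :: "'a pair_pre_digraph \<Rightarrow> 'a set \<Rightarrow> bool" where
  "independent_set G S \<longleftrightarrow> S \<subseteq> pverts G \<and> (\<forall>u\<in>S. \<forall>v\<in>S. (u, v) \<notin> parcs G)"

text \<open>The classes are indexed by \<open>{..<k}\<close>, so that some of them may be empty.\<close>

definition equitably_colorable :: "'a pair_pre_digraph \<Rightarrow> nat \<Rightarrow> bool" where
  "equitably_colorable G k \<longleftrightarrow>
     (\<exists>V :: nat \<Rightarrow> 'a set.
        (\<Union>i<k. V i) = pverts G \<and>
        disjoint_family_on V {..<k} \<and>
        (\<forall>i<k. independent_set G (V i)) \<and>
        (\<forall>i<k. \<forall>j<k. \<bar>int (card (V i)) - int (card (V j))\<bar> \<le> 1))"

definition equitable_chromatic_number :: "'a pair_pre_digraph \<Rightarrow> nat" where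
  "equitable_chromatic_number G = (LEAST k. equitably_colorable G k)"

text \<open>A simple graph for \<open>m \<ge> 3\<close> only: \<open>m = 1\<close> gives a loop and \<open>m = 2\<close> a single edge.\<close>

definition cycle_graph :: "nat \<Rightarrow> nat pair_pre_digraph" where
  "cycle_graph m =
     \<lparr> pverts = {..<m},
       parcs = {(i, j). i < m \<and> j < m \<and> (j = Suc i mod m \<or> i = Suc j mod m)} \<rparr>"

text \<open>
  \<open>(v, None)\<close> is the vertex \<open>v\<close> of \<open>G\<close>, and \<open>(v, Some x)\<close> is the vertex \<open>x\<close> in the copy of \<open>H\<close>
  belonging to \<open>v\<close>.
\<close>

definition corona ::
  "'a pair_pre_digraph \<Rightarrow> 'b pair_pre_digraph \<Rightarrow> ('a \<times> 'b option) pair_pre_digraph" where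
  "corona G H =
     \<lparr> pverts = {(v, None) |v. v \<in> pverts G} \<union> {(v, Some x) |v x. v \<in> pverts G \<and> x \<in> pverts H},
       parcs = {((u, None), (v, None)) |u v. (u, v) \<in> parcs G}
         \<union> {((v, Some x), (v, Some y)) |v x y. v \<in> pverts G \<and> (x, y) \<in> parcs H}
         \<union> {((v, None), (v, Some x)) |v x. v \<in> pverts G \<and> x \<in> pverts H}
         \<union> {((v, Some x), (v, None)) |v x. v \<in> pverts G \<and> x \<in> pverts H} \<rparr>"

definition relabel :: "('a \<Rightarrow> 'b) \<Rightarrow> 'a pair_pre_digraph \<Rightarrow> 'b pair_pre_digraph" where
  "relabel f G = \<lparr> pverts = f ` pverts G, parcs = map_prod f f ` parcs G \<rparr>"

text \<open>
  Each corona changes the vertex type. To iterate, vertices are relabelled injectively by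
  pairs of a vertex of \<open>G\<close> and the list of the second components introduced so far, the most recent
  one first. Exponent 0 gives \<open>G\<close> and exponent 1 gives \<open>corona G H\<close>, up to these labels.
\<close>

definition push_label :: "('a \<times> 'b list) \<times> 'b \<Rightarrow> 'a \<times> 'b list" where
  "push_label = (\<lambda>((v, xs), x). (v, x # xs))"

primrec corona_power ::
  "'a pair_pre_digraph \<Rightarrow> nat \<Rightarrow> 'b pair_pre_digraph \<Rightarrow> ('a \<times> 'b option list) pair_pre_digraph"
where
  "corona_power G 0 H = relabel (\<lambda>v. (v, [])) G"
| "corona_power G (Suc l) H = relabel push_label (corona (corona_power G l H) H)"

lemma inj_push_label: "inj push_label"
  by (auto simp: inj_def push_label_def)

lemma corona_relabel: "corona (relabel f G) H = relabel (map_prod f id) (corona G H)"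
proof -
  have "pverts (corona (relabel f G) H) = map_prod f id ` pverts (corona G H)"
    unfolding corona_def relabel_def by (auto simp: image_Un) (force simp: image_iff)+
  moreover have "parcs (corona (relabel f G) H)
      = map_prod (map_prod f id) (map_prod f id) ` parcs (corona G H)"
    unfolding corona_def relabel_def by (auto simp: image_Un) (force simp: image_iff)+
  ultimately show ?thesis
    unfolding relabel_def by (simp add: corona_def)
qed

lemma relabel_relabel: "relabel f (relabel g G) = relabel (f \<circ> g) G"
  by (simp add: relabel_def image_comp map_prod_compose)

lemma corona_power_1:
  fixes G :: "'a pair_pre_digraph" and H :: "'b pair_pre_digraph"
  shows "corona_power G 1 H = relabel (\<lambda>(v, x). (v, [x])) (corona G H)"
proof -
  have "push_label \<circ> map_prod (\<lambda>v. (v, [])) id = (\<lambda>(v :: 'a, x :: 'b option). (v, [x]))"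
    by (auto simp: push_label_def)
  then show ?thesis
    by (simp add: corona_relabel relabel_relabel)
qed

lemma pair_graph_iff:
  "pair_graph G \<longleftrightarrow>
     finite (pverts G) \<and> parcs G \<subseteq> pverts G \<times> pverts G \<and> sym (parcs G) \<and> irrefl (parcs G)"
proof
  assume "pair_graph G"
  then interpret pair_graph G .
  show "finite (pverts G) \<and> parcs G \<subseteq> pverts G \<times> pverts G \<and> sym (parcs G) \<and> irrefl (parcs G)"
    using pair_finite_verts pair_sym_arcs no_loops'
    by (auto simp: irrefl_def symmetric_def dest: in_arcsD1 in_arcsD2)
next
  assume *: "finite (pverts G) \<and> parcs G \<subseteq> pverts G \<times> pverts G \<and> sym (parcs G) \<and> irrefl (parcs G)"
  then have "finite (parcs G)"
    by (meson finite_SigmaI finite_subset)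
  with * show "pair_graph G"
    by unfold_locales (auto simp: irrefl_def symmetric_def)
qed

lemma pair_graph_cycle_graph:
  assumes "3 \<le> m"
  shows "pair_graph (cycle_graph m)"
proof -
  have "i \<noteq> Suc i mod m" if "i < m" for i
    using that assms by (cases "Suc i = m") auto
  then show ?thesis
    unfolding pair_graph_iff by (auto simp: cycle_graph_def sym_def irrefl_def)
qed

lemma pair_graph_relabel:
  assumes "pair_graph G" "inj f"
  shows "pair_graph (relabel f G)"
  using assms unfolding pair_graph_iff relabel_def sym_def irrefl_def
  by (fastforce simp: inj_eq)

lemma pair_graph_corona:
  assumes "pair_graph G" "pair_graph H"
  shows "pair_graph (corona G H)"
proof -
  have "pverts (corona G H) \<subseteq> pverts G \<times> (insert None (Some ` pverts H))"
    by (auto simp: corona_def)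
  then have "finite (pverts (corona G H))"
    using assms unfolding pair_graph_iff by (meson finite_SigmaI finite_imageI finite_insert finite_subset)
  then show ?thesis
    using assms unfolding pair_graph_iff by (auto simp: corona_def sym_def irrefl_def)
qed

lemma pair_graph_corona_power:
  assumes "pair_graph G" "pair_graph H"
  shows "pair_graph (corona_power G l H)"
  by (induction l)
     (auto intro!: pair_graph_relabel pair_graph_corona assms inj_push_label simp: inj_def)

end

theory Submission
  imports Defs
begin

text \<open>
  Lower bound: the corona contains triangles, so at least three colours are needed. In a
  3-colouring of \<open>P \<circ> C\<^bsub>2k\<^esub>\<close> every copy of the cycle uses the two colours different from that of its centre
  exactly \<open>k\<close> times each, so a class with \<open>a\<close> centres has \<open>k |P| - (k - 1) a\<close> vertices. As
  \<open>k - 1 \<ge> 2\<close>, an equitable colouring forces the three classes to be equally large on \<open>P\<close>. Such a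
  colouring of \<open>P\<close> is again equitable, so the argument descends to \<open>G\<close> and shows \<open>3 | n\<close>.

  Upper bound: an equitable 4-colouring of \<open>P\<close> extends to one of \<open>P \<circ> C\<^bsub>2k\<^esub>\<close>. One may colour a cycle by
  giving all even positions to one of the three colours available and splitting the odd positions
  between the other two in any proportion. Four centres of different colours can be balanced among
  themselves, which leaves a bounded number of centres to be treated explicitly.
\<close>

section \<open>Colourings as functions, under relabelling and corona\<close>

definition proper_coloring :: "'a pair_pre_digraph \<Rightarrow> nat \<Rightarrow> ('a \<Rightarrow> nat) \<Rightarrow> bool" where
  "proper_coloring G m f \<longleftrightarrow>
     (\<forall>v\<in>pverts G. f v < m) \<and> (\<forall>u v. (u, v) \<in> parcs G \<longrightarrow> f u \<noteq> f v)"

definition class_size :: "'a pair_pre_digraph \<Rightarrow> ('a \<Rightarrow> nat) \<Rightarrow> nat \<Rightarrow> nat" where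
  "class_size G f c = card {v \<in> pverts G. f v = c}"

text \<open>Replaces families of classes by colour functions, which can be restricted to the centres
  and copies of a corona. Since \<open>pair_graph\<close> keeps the ends of arcs inside
  \<open>pverts G\<close>, values of \<open>f\<close> elsewhere do not matter.\<close>

lemma equitably_colorable_iff:
  assumes "pair_graph G"
  shows "equitably_colorable G m \<longleftrightarrow>
    (\<exists>f. proper_coloring G m f \<and> (\<forall>i<m. \<forall>j<m. class_size G f i \<le> class_size G f j + 1))"
proof
  assume "equitably_colorable G m"
  then obtain V :: "nat \<Rightarrow> 'a set" where V: "(\<Union>i<m. V i) = pverts G"
      "disjoint_family_on V {..<m}"
      "\<And>i. i < m \<Longrightarrow> independent_set G (V i)"
      "\<And>i j. i < m \<Longrightarrow> j < m \<Longrightarrow> \<bar>int (card (V i)) - int (card (V j))\<bar> \<le> 1"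
    unfolding equitably_colorable_def by blast
  have "\<forall>v\<in>pverts G. \<exists>i<m. v \<in> V i"
    using V(1) by blast
  then obtain f where f: "\<And>v. v \<in> pverts G \<Longrightarrow> f v < m \<and> v \<in> V (f v)"
    by metis
  have uniq: "f v = i" if "v \<in> V i" "i < m" for v i
  proof (rule ccontr)
    assume "f v \<noteq> i"
    moreover have "v \<in> pverts G"
      using V(1) that by blast
    ultimately show False
      using V(2) f that unfolding disjoint_family_on_def by blast
  qed
  have cls: "{v \<in> pverts G. f v = i} = V i" if "i < m" for i
    using f uniq that V(1) by blast
  have "proper_coloring G m f"
    unfolding proper_coloring_def
  proof (intro conjI ballI allI impI)
    fix u v assume uv: "(u, v) \<in> parcs G"
    then have "u \<in> pverts G" "v \<in> pverts G"
      using assms unfolding pair_graph_iff by auto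
    then show "f u \<noteq> f v"
      using f V(3) uv unfolding independent_set_def by metis
  qed (use f in auto)
  moreover have "class_size G f i \<le> class_size G f j + 1" if "i < m" "j < m" for i j
    using V(4)[OF that] that by (simp add: class_size_def cls)
  ultimately show "\<exists>f. proper_coloring G m f \<and>
      (\<forall>i<m. \<forall>j<m. class_size G f i \<le> class_size G f j + 1)"
    by blast
next
  assume "\<exists>f. proper_coloring G m f \<and>
      (\<forall>i<m. \<forall>j<m. class_size G f i \<le> class_size G f j + 1)"
  then obtain f where f: "proper_coloring G m f"
      "\<And>i j. i < m \<Longrightarrow> j < m \<Longrightarrow> class_size G f i \<le> class_size G f j + 1"
    by blast
  define V where "V i = {v \<in> pverts G. f v = i}" for i
  have "\<bar>int (card (V i)) - int (card (V j))\<bar> \<le> 1" if "i < m" "j < m" for i j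
    using f(2)[of i j] f(2)[of j i] that unfolding class_size_def V_def by linarith
  moreover have "(\<Union>i<m. V i) = pverts G" "disjoint_family_on V {..<m}"
      "\<forall>i<m. independent_set G (V i)"
    using f(1) unfolding V_def proper_coloring_def disjoint_family_on_def independent_set_def
    by (auto; metis)+
  ultimately show "equitably_colorable G m"
    unfolding equitably_colorable_def by blast
qed

lemma proper_coloring_relabel:
  "proper_coloring (relabel r G) m f \<longleftrightarrow> proper_coloring G m (f \<circ> r)"
proof -
  have "(\<forall>u v. (u, v) \<in> map_prod r r ` parcs G \<longrightarrow> f u \<noteq> f v) \<longleftrightarrow>
      (\<forall>u v. (u, v) \<in> parcs G \<longrightarrow> f (r u) \<noteq> f (r v))"
    by (blast intro: map_prod_imageI elim: prod_fun_imageE)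
  then show ?thesis
    by (simp add: proper_coloring_def relabel_def)
qed

lemma class_size_relabel:
  assumes "inj r"
  shows "class_size (relabel r G) f c = class_size G (f \<circ> r) c"
proof -
  have "{v \<in> pverts (relabel r G). f v = c} = r ` {v \<in> pverts G. (f \<circ> r) v = c}"
    by (auto simp: relabel_def)
  then show ?thesis
    unfolding class_size_def using card_image[OF inj_on_subset[OF assms subset_UNIV]] by simp
qed

lemma equitably_colorable_relabel:
  assumes "pair_graph G" "inj r"
  shows "equitably_colorable (relabel r G) m \<longleftrightarrow> equitably_colorable G m"
proof -
  \<comment> \<open>Injectivity makes every colouring of \<open>G\<close> the pullback along
    \<open>r\<close> of some colouring, namely of \<open>f \<circ> inv r\<close>.\<close>
  have "(\<exists>f. P (f \<circ> r)) \<longleftrightarrow> (\<exists>f. P f)" for P :: "('a \<Rightarrow> nat) \<Rightarrow> bool"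
  proof
    assume "\<exists>f. P f"
    then obtain f where "P f" ..
    moreover have "(f \<circ> inv r) \<circ> r = f"
      using assms(2) by (simp add: comp_assoc)
    ultimately show "\<exists>f. P (f \<circ> r)"
      by metis
  qed blast
  then show ?thesis
    by (simp add: equitably_colorable_iff assms pair_graph_relabel proper_coloring_relabel
        class_size_relabel)
qed

lemma class_size_corona:
  fixes G :: "'a pair_pre_digraph" and H :: "'b pair_pre_digraph"
  assumes "finite (pverts G)" "finite (pverts H)"
  shows "class_size (corona G H) f c =
    class_size G (\<lambda>v. f (v, None)) c
      + (\<Sum>v\<in>pverts G. class_size H (\<lambda>x. f (v, Some x)) c)"
proof -
  let ?A = "(\<lambda>v. (v, None :: 'b option)) ` {v \<in> pverts G. f (v, None) = c}"
  let ?B = "(\<lambda>(v, x). (v, Some x)) `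
    (SIGMA v:pverts G. {x \<in> pverts H. f (v, Some x) = c})"
  have "{w \<in> pverts (corona G H). f w = c} = ?A \<union> ?B"
    by (auto simp: corona_def image_iff)
  moreover have "finite ?A" "finite ?B" "?A \<inter> ?B = {}"
    using assms by (auto intro!: finite_imageI)
  moreover have "card ?A = class_size G (\<lambda>v. f (v, None)) c"
    unfolding class_size_def by (rule card_image) (auto simp: inj_on_def)
  moreover have "card ?B = (\<Sum>v\<in>pverts G. class_size H (\<lambda>x. f (v, Some x)) c)"
    using assms unfolding class_size_def
    by (subst card_image) (auto simp: inj_on_def)
  ultimately show ?thesis
    unfolding class_size_def[of "corona G H"] by (simp only: card_Un_disjoint)
qed

lemma proper_coloring_corona:
  "proper_coloring (corona G H) m f \<longleftrightarrow>
     proper_coloring G m (\<lambda>v. f (v, None)) \<and>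
     (\<forall>v\<in>pverts G. proper_coloring H m (\<lambda>x. f (v, Some x)) \<and>
        (\<forall>x\<in>pverts H. f (v, Some x) \<noteq> f (v, None)))"
proof -
  have "(\<forall>w\<in>pverts (corona G H). f w < m) \<longleftrightarrow>
      (\<forall>v\<in>pverts G. f (v, None) < m \<and> (\<forall>x\<in>pverts H. f (v, Some x) < m))"
    by (auto simp: corona_def)
  moreover have "(\<forall>w z. (w, z) \<in> parcs (corona G H) \<longrightarrow> f w \<noteq> f z) \<longleftrightarrow>
      (\<forall>u v. (u, v) \<in> parcs G \<longrightarrow> f (u, None) \<noteq> f (v, None)) \<and>
      (\<forall>v\<in>pverts G. (\<forall>x y. (x, y) \<in> parcs H \<longrightarrow> f (v, Some x) \<noteq> f (v, Some y)) \<and>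
        (\<forall>x\<in>pverts H. f (v, Some x) \<noteq> f (v, None)))" (is "?l \<longleftrightarrow> ?r")
  proof
    assume ?l
    then show ?r
      by (simp add: corona_def)
  next
    assume r: ?r
    show ?l
    proof (intro allI impI)
      fix w z assume "(w, z) \<in> parcs (corona G H)"
      then consider u v where "w = (u, None)" "z = (v, None)" "(u, v) \<in> parcs G"
        | v x y where "w = (v, Some x)" "z = (v, Some y)" "v \<in> pverts G" "(x, y) \<in> parcs H"
        | v x where "w = (v, None)" "z = (v, Some x)" "v \<in> pverts G" "x \<in> pverts H"
        | v x where "w = (v, Some x)" "z = (v, None)" "v \<in> pverts G" "x \<in> pverts H"
        unfolding corona_def by auto
      then show "f w \<noteq> f z"
        using r by cases force+
    qed
  qed
  ultimately show ?thesis
    unfolding proper_coloring_def by blast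
qed

subsection \<open>Four colours suffice\<close>

text \<open>On an even cycle the odd positions are pairwise non-adjacent, so once colour
  \<open>A\<close> fills the even ones, the odd ones can be shared freely between \<open>B\<close>
  and \<open>C\<close>.\<close>

lemma cycle_coloring:
  assumes "distinct [A, B, C]" "A < m" "B < m" "C < m" "x + y = k"
  obtains g where "proper_coloring (cycle_graph (2 * k)) m g"
    "\<And>i. g i \<in> {A, B, C}"
    "class_size (cycle_graph (2 * k)) g A = k"
    "class_size (cycle_graph (2 * k)) g B = x"
    "class_size (cycle_graph (2 * k)) g C = y"
proof
  define g where "g i = (if even i then A else if i div 2 < x then B else C)" for i :: nat
  \<comment> \<open>As the length is even, parity flips also at the wrap-around to position
    \<open>0\<close>.\<close>
  have par: "even (Suc i mod (2 * k)) \<longleftrightarrow> odd i" for i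
    by (simp add: dvd_mod_iff)
  show "g i \<in> {A, B, C}" for i
    by (simp add: g_def)
  have neq: "g i \<noteq> g (Suc i mod (2 * k))" for i
    unfolding g_def using par[of i] assms(1) by auto
  have "g i < m" for i
    using assms by (simp add: g_def)
  then show "proper_coloring (cycle_graph (2 * k)) m g"
    unfolding proper_coloring_def cycle_graph_def using neq neq[symmetric] by auto
  have "{i. i < 2 * k \<and> g i = A} = (\<lambda>j. 2 * j) ` {..<k}"
    using assms(1) by (auto simp: g_def image_iff elim!: evenE)
  moreover have "card \<dots> = k"
    by (subst card_image) (auto simp: inj_on_def)
  ultimately show "class_size (cycle_graph (2 * k)) g A = k"
    by (simp add: class_size_def cycle_graph_def)
  have "{i. i < 2 * k \<and> g i = B} = (\<lambda>j. 2 * j + 1) ` {..<x}"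
    using assms(1,5) by (auto simp: g_def image_iff elim!: oddE)
  moreover have "card \<dots> = x"
    by (subst card_image) (auto simp: inj_on_def)
  ultimately show "class_size (cycle_graph (2 * k)) g B = x"
    by (simp add: class_size_def cycle_graph_def)
  have "{i. i < 2 * k \<and> g i = C} = (\<lambda>j. 2 * j + 1) ` {x..<x + y}"
    using assms(1,5) by (auto simp: g_def image_iff elim!: oddE)
  moreover have "card \<dots> = y"
    by (subst card_image) (auto simp: inj_on_def)
  ultimately show "class_size (cycle_graph (2 * k)) g C = y"
    by (simp add: class_size_def cycle_graph_def)
qed

text \<open>
  \<open>extends_to H f V t\<close>: when the vertices in \<open>V\<close> carry the colours \<open>f\<close>, their copies of \<open>H\<close> can be
  coloured so that together with \<open>V\<close> they use each colour \<open>c < 4\<close> exactly \<open>t c\<close> times.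
\<close>

definition extends_to ::
  "'b pair_pre_digraph \<Rightarrow> ('a \<Rightarrow> nat) \<Rightarrow> 'a set \<Rightarrow> (nat \<Rightarrow> nat) \<Rightarrow> bool" where
  "extends_to H f V t \<longleftrightarrow> finite V \<and>
     (\<exists>g. (\<forall>v\<in>V. proper_coloring H 4 (g v) \<and> (\<forall>x\<in>pverts H. g v x \<noteq> f v)) \<and>
          (\<forall>c<4. card {v \<in> V. f v = c} + (\<Sum>v\<in>V. class_size H (g v) c) = t c))"

text \<open>No arc joins copies of \<open>H\<close> at different centres, so colourings of the
  copies over disjoint sets of centres can be chosen independently and the totals add up.\<close>

lemma extends_to_Un:
  assumes "extends_to H f V t" "extends_to H f W u" "V \<inter> W = {}"
  shows "extends_to H f (V \<union> W) (\<lambda>c. t c + u c)"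
proof -
  have fin: "finite V" "finite W"
    using assms by (auto simp: extends_to_def)
  from assms(1) obtain g where
    g: "\<And>v. v \<in> V \<Longrightarrow> proper_coloring H 4 (g v) \<and> (\<forall>x\<in>pverts H. g v x \<noteq> f v)"
       "\<And>c. c < 4 \<Longrightarrow> card {v \<in> V. f v = c} + (\<Sum>v\<in>V. class_size H (g v) c) = t c"
    unfolding extends_to_def by blast
  from assms(2) obtain h where
    h: "\<And>v. v \<in> W \<Longrightarrow> proper_coloring H 4 (h v) \<and> (\<forall>x\<in>pverts H. h v x \<noteq> f v)"
       "\<And>c. c < 4 \<Longrightarrow> card {v \<in> W. f v = c} + (\<Sum>v\<in>W. class_size H (h v) c) = u c"
    unfolding extends_to_def by blast
  let ?g = "\<lambda>v. if v \<in> V then g v else h v"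
  have "card {v \<in> V \<union> W. f v = c} + (\<Sum>v\<in>V \<union> W. class_size H (?g v) c) = t c + u c"
    if "c < 4" for c
  proof -
    have "card ({v \<in> V. f v = c} \<union> {v \<in> W. f v = c})
        = card {v \<in> V. f v = c} + card {v \<in> W. f v = c}"
      using fin assms(3) by (intro card_Un_disjoint) auto
    moreover have "{v \<in> V. f v = c} \<union> {v \<in> W. f v = c} = {v \<in> V \<union> W. f v = c}"
      by auto
    ultimately have 1: "card {v \<in> V \<union> W. f v = c} = card {v \<in> V. f v = c} + card {v \<in> W. f v = c}"
      by simp
    have "(\<Sum>v\<in>W. class_size H (?g v) c) = (\<Sum>v\<in>W. class_size H (h v) c)"
      using assms(3) by (intro sum.cong) auto
    then have "(\<Sum>v\<in>V \<union> W. class_size H (?g v) c)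
        = (\<Sum>v\<in>V. class_size H (g v) c) + (\<Sum>v\<in>W. class_size H (h v) c)"
      using fin assms(3) by (simp add: sum.union_disjoint)
    with 1 g(2)[OF that] h(2)[OF that] show ?thesis
      by simp
  qed
  then show ?thesis
    unfolding extends_to_def using fin g(1) h(1) by (intro conjI exI[of _ ?g]) auto
qed

lemma extends_to_cong:
  assumes "extends_to H f V t" "\<And>c. c < 4 \<Longrightarrow> t c = u c"
  shows "extends_to H f V u"
  using assms by (simp add: extends_to_def)

lemma four_colors:
  fixes c :: nat
  assumes "distinct [P, A, B, C]" "P < 4" "A < 4" "B < 4" "C < 4" "c < 4"
  shows "c \<in> {P, A, B, C}"
proof -
  have "{P, A, B, C} = {..<4}"
    using assms by (intro card_subset_eq) auto
  then show ?thesis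
    using assms(6) by blast
qed

text \<open>The new centre counts once for its own colour, and its copy is coloured by
  \<open>cycle_coloring\<close>. Among the colours below 4, the final \<open>else y\<close> is
  reached by \<open>C\<close> alone.\<close>

lemma extends_to_insert:
  assumes "extends_to (cycle_graph (2 * k)) f V t" "v \<notin> V" "f v = P"
    and "distinct [P, A, B, C]" "P < 4" "A < 4" "B < 4" "C < 4" "x + y = k"
  shows "extends_to (cycle_graph (2 * k)) f (insert v V)
    (\<lambda>c. t c + (if c = P then 1 else if c = A then k else if c = B then x else y))"
proof -
  obtain g where g: "proper_coloring (cycle_graph (2 * k)) 4 g" "\<And>i. g i \<in> {A, B, C}"
    "class_size (cycle_graph (2 * k)) g A = k"
    "class_size (cycle_graph (2 * k)) g B = x"
    "class_size (cycle_graph (2 * k)) g C = y"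
    using cycle_coloring[of A B C 4 x y k] assms(4-9) by (metis distinct_length_2_or_more)
  have gP: "g i \<noteq> P" for i
    using g(2)[of i] assms(4) by auto
  then have P: "class_size (cycle_graph (2 * k)) g P = 0"
    by (simp add: class_size_def)
  define u where "u = (\<lambda>c. if c = P then 1 else if c = A then k else if c = B then x else y)"
  have "extends_to (cycle_graph (2 * k)) f {v} u"
    unfolding extends_to_def
  proof (intro conjI exI[of _ "\<lambda>_. g"] allI impI)
    fix c :: nat assume "c < 4"
    then have "c \<in> {P, A, B, C}"
      using assms(4-8) four_colors by blast
    moreover have "{w \<in> {v}. f w = c} = (if c = P then {v} else {})"
      using assms(3) by auto
    ultimately show "card {w \<in> {v}. f w = c} +
        (\<Sum>w\<in>{v}. class_size (cycle_graph (2 * k)) g c) = u c"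
      using assms(4) g P by (auto simp: u_def)
  qed (use g(1) gP assms(3) in auto)
  from extends_to_Un[OF assms(1) this] assms(2) show ?thesis
    by (simp add: u_def)
qed

lemma extends_to_empty: "extends_to H f {} (\<lambda>_. 0)"
  by (simp add: extends_to_def)

text \<open>Rotating one pattern cyclically through the four colours gives each colour one centre
  and \<open>k\<close> vertices in each of two copies, hence \<open>2 * k + 1\<close> in
  all.\<close>

lemma extends_to_rainbow:
  assumes V: "extends_to (cycle_graph (2 * k)) f V t" "w0 \<notin> V" "w1 \<notin> V" "w2 \<notin> V" "w3 \<notin> V"
    and p: "distinct [p0, p1, p2, p3]" "p0 < 4" "p1 < 4" "p2 < 4" "p3 < 4"
    and fw: "f w0 = p0" "f w1 = p1" "f w2 = p2" "f w3 = p3"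
  shows "extends_to (cycle_graph (2 * k)) f (insert w0 (insert w1 (insert w2 (insert w3 V))))
    (\<lambda>c. t c + (2 * k + 1))"
proof -
  have w: "distinct [w0, w1, w2, w3]"
    using p(1) fw by auto
  \<comment> \<open>With \<open>y = 0\<close> every copy uses only two colours, \<open>k\<close>
    times each.\<close>
  note e = extends_to_insert[where k = k and f = f and x = k and y = 0, OF _ _ _ _ _ _ _ _ add_0_right]
  note e3 = e[OF V(1), of w3 p3 p0 p1 p2]
  note e2 = e[OF e3, of w2 p2 p3 p0 p1]
  note e1 = e[OF e2, of w1 p1 p2 p3 p0]
  note e0 = e[OF e1, of w0 p0 p1 p2 p3]
  have cong: "extends_to H f W u"
    if "extends_to H f W s" "\<forall>c\<in>{p0, p1, p2, p3}. s c = u c" for H :: "nat pair_pre_digraph" and W s u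
    using that four_colors[OF p] extends_to_cong by blast
  show ?thesis
    by (rule cong[OF e0]) (use V(2-) w p fw in auto)
qed

text \<open>
  Removing a rainbow quadruple adds \<open>2 * k + 1\<close> to every total, so it suffices to treat two, three,
  four or five vertices. A single vertex would not do for \<open>k \<ge> 4\<close>: its colour is used only once.
\<close>

lemma balanced_extension:
  assumes "distinct [p0, p1, p2, p3]" "p0 < 4" "p1 < 4" "p2 < 4" "p3 < 4"
    and "finite S0" "finite S1" "finite S2" "finite S3"
    and "\<And>v. v \<in> S0 \<Longrightarrow> f v = p0" "\<And>v. v \<in> S1 \<Longrightarrow> f v = p1"
      "\<And>v. v \<in> S2 \<Longrightarrow> f v = p2" "\<And>v. v \<in> S3 \<Longrightarrow> f v = p3"
    and "card S3 \<le> card S2" "card S2 \<le> card S1" "card S1 \<le> card S0" "card S0 \<le> card S3 + 1"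
    and "2 \<le> card S0 + card S1 + card S2 + card S3"
  shows "\<exists>t. extends_to (cycle_graph (2 * k)) f (S0 \<union> S1 \<union> S2 \<union> S3) t \<and>
    (\<forall>i<4. \<forall>j<4. t i \<le> t j + 1)"
  using assms(6-)
\<comment> \<open>\<open>S3\<close> is the smallest class, so its size is the number of disjoint
  rainbow quadruples available.\<close>
proof (induction "card S3" arbitrary: S0 S1 S2 S3)
  note p = assms(1-5)
  note e = extends_to_insert[where k = k and f = f]
  have ne: "p0 \<noteq> p1" "p0 \<noteq> p2" "p0 \<noteq> p3" "p1 \<noteq> p2" "p1 \<noteq> p3" "p2 \<noteq> p3"
    using p(1) by auto
  \<comment> \<open>The two halves of \<open>k\<close>, rounded down and up; splitting odd positions
    this way evens out the totals.\<close>
  define h h' where "h = k div 2" "h' = k - h"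
  then have h: "h + h' = k" "h \<le> h'" "h' \<le> Suc h"
    by linarith+
  have balancedI: "\<exists>t. extends_to (cycle_graph (2 * k)) f V t \<and> (\<forall>i<4. \<forall>j<4. t i \<le> t j + 1)"
    if "extends_to (cycle_graph (2 * k)) f V t"
      "\<forall>i\<in>{p0, p1, p2, p3}. \<forall>j\<in>{p0, p1, p2, p3}. t i \<le> t j + 1" for V t
    using that four_colors[OF p] by blast
  {
    case 0
    \<comment> \<open>With \<open>S3\<close> empty no class has more than one vertex, so only two or
      three centres remain.\<close>
    have "S3 = {}"
      using 0 by simp
    moreover have "card S0 = 1" "card S1 = 1" "card S2 = 0 \<or> card S2 = 1"
      using 0 by linarith+
    ultimately obtain w0 w1 where S: "S3 = {}" "S0 = {w0}" "S1 = {w1}"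
      by (metis card_1_singletonE)
    with 0 have fw: "f w0 = p0" "f w1 = p1"
      by auto
    then have w: "w0 \<noteq> w1"
      using p by auto
    show ?case
    proof (cases "card S2 = 0")
      case True
      then have S2: "S2 = {}"
        using 0 by simp
      \<comment> \<open>The halves are swapped between the two centres: \<open>p0\<close> and
        \<open>p1\<close> get \<open>k + 1\<close> each, \<open>p2\<close> and \<open>p3\<close> get
        \<open>h + h' = k\<close>.\<close>
      note e1 = e[OF extends_to_empty, of w1 p1 p0 p2 p3 h h']
      note e0 = e[OF e1, of w0 p0 p1 p3 p2 h h']
      have "\<exists>t. extends_to (cycle_graph (2 * k)) f {w0, w1} t \<and> (\<forall>i<4. \<forall>j<4. t i \<le> t j + 1)"
        by (rule balancedI[OF e0]) (use h in \<open>simp_all add: p(2-) ne ne[symmetric] w fw\<close>)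
      then show ?thesis
        by (simp add: S S2 insert_commute)
    next
      case False
      then obtain w2 where S2: "S2 = {w2}"
        using \<open>card S2 = 0 \<or> card S2 = 1\<close> by (metis card_1_singletonE)
      then have fw2: "f w2 = p2"
        using 0 by auto
      have w': "w0 \<noteq> w2" "w1 \<noteq> w2"
        using ne fw fw2 by metis+
      \<comment> \<open>The colours \<open>p0\<close>, \<open>p1\<close>, \<open>p2\<close> get
        \<open>k + h + 1\<close> each and the absent colour \<open>p3\<close> gets
        \<open>3 * h'\<close>. The difference is exactly one, with sign depending on the parity of
        \<open>k\<close>.\<close>
      note e2 = e[OF extends_to_empty, of w2 p2 p0 p1 p3 h h']
      note e1 = e[OF e2, of w1 p1 p2 p0 p3 h h']
      note e0 = e[OF e1, of w0 p0 p1 p2 p3 h h']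
      have "\<exists>t. extends_to (cycle_graph (2 * k)) f {w0, w1, w2} t \<and>
          (\<forall>i<4. \<forall>j<4. t i \<le> t j + 1)"
        by (rule balancedI[OF e0]) (use h in \<open>simp_all add: p(2-) ne ne[symmetric] w w' fw fw2\<close>)
      then show ?thesis
        by (simp add: S S2 insert_commute)
    qed
  next
    case (Suc q)
    have "0 < card S0" "0 < card S1" "0 < card S2" "0 < card S3"
      using Suc.hyps(2) Suc.prems(9-12) by linarith+
    then obtain w0 w1 w2 w3 where w: "w0 \<in> S0" "w1 \<in> S1" "w2 \<in> S2" "w3 \<in> S3"
      by (metis card_gt_0_iff equals0I)
    then have fw: "f w0 = p0" "f w1 = p1" "f w2 = p2" "f w3 = p3"
      using Suc.prems(5-8) by blast+
    define T0 T1 T2 T3 where T_defs: "T0 = S0 - {w0}" "T1 = S1 - {w1}" "T2 = S2 - {w2}" "T3 = S3 - {w3}"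
    have T: "S0 = insert w0 T0" "S1 = insert w1 T1" "S2 = insert w2 T2" "S3 = insert w3 T3"
      "w0 \<notin> T0" "w1 \<notin> T1" "w2 \<notin> T2" "w3 \<notin> T3"
      using w by (auto simp: T_defs)
    have fT: "\<And>v. v \<in> T0 \<Longrightarrow> f v = p0" "\<And>v. v \<in> T1 \<Longrightarrow> f v = p1"
        "\<And>v. v \<in> T2 \<Longrightarrow> f v = p2" "\<And>v. v \<in> T3 \<Longrightarrow> f v = p3"
      and finT: "finite T0" "finite T1" "finite T2" "finite T3"
      using Suc.prems(1-8) unfolding T_defs by blast+
    have cT: "card S0 = Suc (card T0)" "card S1 = Suc (card T1)"
        "card S2 = Suc (card T2)" "card S3 = Suc (card T3)"
      using T(5-8) finT by (simp_all add: T(1-4))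
    let ?T = "T0 \<union> T1 \<union> T2 \<union> T3"
    have U: "S0 \<union> S1 \<union> S2 \<union> S3 = insert w0 (insert w1 (insert w2 (insert w3 ?T)))"
      by (auto simp: T)
    have notin: "\<And>v. f v \<noteq> p0 \<Longrightarrow> v \<notin> T0" "\<And>v. f v \<noteq> p1 \<Longrightarrow> v \<notin> T1"
        "\<And>v. f v \<noteq> p2 \<Longrightarrow> v \<notin> T2" "\<And>v. f v \<noteq> p3 \<Longrightarrow> v \<notin> T3"
      using fT by blast+
    have nT: "w0 \<notin> ?T" "w1 \<notin> ?T" "w2 \<notin> ?T" "w3 \<notin> ?T"
      using T(5-8) p(1) by (simp_all add: notin fw)
    \<comment> \<open>Adding the same constant to all four totals preserves balance.\<close>
    have rainbow: ?case
      if "extends_to (cycle_graph (2 * k)) f ?T t" "\<forall>i<4. \<forall>j<4. t i \<le> t j + 1" for t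
      unfolding U using extends_to_rainbow[OF that(1) nT p fw] that(2)
      by (intro exI[of _ "\<lambda>c. t c + (2 * k + 1)"]) auto
    \<comment> \<open>Either the induction hypothesis applies to the rest, or the rest is empty
      (four centres), or it is a single centre of colour \<open>p0\<close>, in which case all five
      centres are coloured together.\<close>
    consider "2 \<le> card T0 + card T1 + card T2 + card T3"
      | "T0 = {}" "T1 = {}" "T2 = {}" "T3 = {}"
      | "card T0 = 1" "T1 = {}" "T2 = {}" "T3 = {}"
    proof -
      have "card T3 \<le> card T2" "card T2 \<le> card T1" "card T1 \<le> card T0"
        using Suc.prems(9-11) cT by linarith+
      then consider "2 \<le> card T0 + card T1 + card T2 + card T3"
        | "card T0 \<le> 1" "card T1 = 0" "card T2 = 0" "card T3 = 0"
        by linarith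
      then show thesis
        using that finT by cases (auto simp: le_Suc_eq)
    qed
    then show ?case
    proof cases
      case 1
      have "\<exists>t. extends_to (cycle_graph (2 * k)) f ?T t \<and> (\<forall>i<4. \<forall>j<4. t i \<le> t j + 1)"
        by (rule Suc.hyps(1))
          (fact finT | erule fT | use Suc.hyps(2) Suc.prems(9-13) cT 1 in linarith)+
      then show ?thesis
        using rainbow by blast
    next
      case 2
      then show ?thesis
        using rainbow[of "\<lambda>_. 0"] by (simp add: extends_to_empty)
    next
      case 3
      then obtain w4 where T0: "T0 = {w4}"
        by (metis card_1_singletonE)
      then have w4: "f w4 = p0" "w4 \<noteq> w0"
        using fT T by auto
      have w5: "w0 \<noteq> w1" "w0 \<noteq> w2" "w0 \<noteq> w3" "w1 \<noteq> w2" "w1 \<noteq> w3" "w2 \<noteq> w3"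
          "w4 \<noteq> w1" "w4 \<noteq> w2" "w4 \<noteq> w3"
        using ne fw w4(1) by metis+
      \<comment> \<open>Totals: \<open>2 * k + h + 2\<close> for \<open>p0\<close>,
        \<open>2 * k + h + 1\<close> for \<open>p1\<close>, and \<open>2 * k + h' + 1\<close> for
        \<open>p2\<close> and \<open>p3\<close>.\<close>
      note e0 = e[OF extends_to_empty, of w4 p0 p1 p2 p3 k 0]
      note e1 = e[OF e0, of w3 p3 p1 p0 p2 h h']
      note e2 = e[OF e1, of w2 p2 p0 p1 p3 h h']
      note e3 = e[OF e2, of w1 p1 p0 p3 p2 k 0]
      note e4 = e[OF e3, of w0 p0 p2 p3 p1 k 0]
      have "\<exists>t. extends_to (cycle_graph (2 * k)) f {w0, w1, w2, w3, w4} t \<and>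
          (\<forall>i<4. \<forall>j<4. t i \<le> t j + 1)"
        by (rule balancedI[OF e4])
          (use h in \<open>simp_all add: p(2-) ne ne[symmetric] w4 w4(2)[symmetric] w5 w5[symmetric] fw\<close>)
      then show ?thesis
        unfolding U by (simp add: 3 T0)
    qed
  }
qed

text \<open>Names the colours by decreasing class size, the order in which
  \<open>balanced_extension\<close> expects the classes.\<close>

lemma sorted_colors:
  fixes a :: "nat \<Rightarrow> nat"
  obtains p0 p1 p2 p3 where "distinct [p0, p1, p2, p3]" "p0 < 4" "p1 < 4" "p2 < 4" "p3 < 4"
    "a p3 \<le> a p2" "a p2 \<le> a p1" "a p1 \<le> a p0"
proof -
  let ?xs = "sort_key a [0..<4]"
  have "length ?xs = 4" "distinct ?xs" "set ?xs = {..<4}" "sorted (map a ?xs)"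
    by (auto simp: atLeast0LessThan)
  moreover have "\<exists>p3 p2 p1 p0. xs = [p3, p2, p1, p0]" if "length xs = 4" for xs :: "nat list"
    using that by (auto simp: numeral_eq_Suc length_Suc_conv)
  then obtain p3 p2 p1 p0 where "?xs = [p3, p2, p1, p0]"
    using \<open>length ?xs = 4\<close> by blast
  ultimately have "distinct [p3, p2, p1, p0]" "{p3, p2, p1, p0} = {..<4}"
      "sorted (map a [p3, p2, p1, p0])"
    by simp_all
  then show thesis
    by (intro that[of p0 p1 p2 p3]) auto
qed

section \<open>Equitable 4-colourings of coronas and their iterates\<close>

text \<open>The centres keep their colours from \<open>G\<close>; \<open>balanced_extension\<close>
  colours the copies.\<close>

lemma equitably_colorable_corona_even_cycle:
  assumes "pair_graph G" "2 \<le> card (pverts G)" "equitably_colorable G 4" "3 \<le> 2 * k"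
  shows "equitably_colorable (corona G (cycle_graph (2 * k))) 4"
proof -
  let ?H = "cycle_graph (2 * k)"
  have fin: "finite (pverts G)" "finite (pverts ?H)"
    using assms(1) pair_graph_cycle_graph[OF assms(4)] by (auto simp: pair_graph_iff)
  obtain f where f: "proper_coloring G 4 f"
      "\<And>i j. i < 4 \<Longrightarrow> j < 4 \<Longrightarrow> class_size G f i \<le> class_size G f j + 1"
    using assms(1,3) by (auto simp: equitably_colorable_iff)
  obtain p0 p1 p2 p3 where p: "distinct [p0, p1, p2, p3]" "p0 < 4" "p1 < 4" "p2 < 4" "p3 < 4"
      and le: "class_size G f p3 \<le> class_size G f p2" "class_size G f p2 \<le> class_size G f p1"
        "class_size G f p1 \<le> class_size G f p0"
    using sorted_colors[of "class_size G f"] by blast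
  define S where "S c = {v \<in> pverts G. f v = c}" for c
  have V: "pverts G = S p0 \<union> S p1 \<union> S p2 \<union> S p3"
  proof
    show "pverts G \<subseteq> S p0 \<union> S p1 \<union> S p2 \<union> S p3"
    proof
      fix v assume v: "v \<in> pverts G"
      then have "f v < 4"
        using f(1) by (simp add: proper_coloring_def)
      then have "f v \<in> {p0, p1, p2, p3}"
        using four_colors[OF p] by simp
      with v show "v \<in> S p0 \<union> S p1 \<union> S p2 \<union> S p3"
        by (auto simp: S_def)
    qed
  qed (auto simp: S_def)
  have card_S: "card (S c) = class_size G f c" for c
    by (simp add: S_def class_size_def)
  have "card (pverts G) \<le> card (S p0) + card (S p1) + card (S p2) + card (S p3)"
    unfolding V by (meson add_le_mono1 card_Un_le order_trans)
  \<comment> \<open>Equitability of \<open>f\<close> enters by comparing the largest class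
    \<open>p0\<close> with the smallest class \<open>p3\<close>.\<close>
  then have "\<exists>t. extends_to ?H f (S p0 \<union> S p1 \<union> S p2 \<union> S p3) t \<and>
      (\<forall>i<4. \<forall>j<4. t i \<le> t j + 1)"
    using le f(2)[of p0 p3] p assms(2) fin(1)
    by (intro balanced_extension[of p0 p1 p2 p3]) (simp_all add: card_S, simp_all add: S_def)
  then obtain t where t: "extends_to ?H f (pverts G) t" "\<And>i j. i < 4 \<Longrightarrow> j < 4 \<Longrightarrow> t i \<le> t j + 1"
    unfolding V by blast
  then obtain g where g: "\<And>v. v \<in> pverts G \<Longrightarrow>
        proper_coloring ?H 4 (g v) \<and> (\<forall>x\<in>pverts ?H. g v x \<noteq> f v)"
      "\<And>c. c < 4 \<Longrightarrow> class_size G f c + (\<Sum>v\<in>pverts G. class_size ?H (g v) c) = t c"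
    unfolding extends_to_def class_size_def[of G] by blast
  define F where "F = (\<lambda>(v, y). case y of None \<Rightarrow> f v | Some x \<Rightarrow> g v x)"
  have "proper_coloring (corona G ?H) 4 F"
    unfolding proper_coloring_corona using f(1) g(1) by (simp add: F_def)
  moreover have "class_size (corona G ?H) F c = t c" if "c < 4" for c
    using g(2)[OF that] by (simp add: class_size_corona[OF fin] F_def)
  ultimately show ?thesis
    using t(2) assms(1) pair_graph_cycle_graph[OF assms(4)]
    by (auto simp: equitably_colorable_iff pair_graph_corona)
qed

text \<open>The centres embed into each corona. This carries the bound of two vertices through the
  iteration and later shows that a corona power is nonempty.\<close>

lemma card_pverts_corona_power:
  assumes "pair_graph G" "pair_graph H"
  shows "card (pverts G) \<le> card (pverts (corona_power G l H))"
proof (induction l)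
  case 0
  show ?case
    by (simp add: relabel_def card_image inj_on_def)
next
  case (Suc l)
  let ?P = "corona_power G l H"
  have "finite (pverts (corona ?P H))"
    using pair_graph_corona[OF pair_graph_corona_power[OF assms] assms(2)] pair_graph_iff by blast
  moreover have "(\<lambda>v. (v, None)) ` pverts ?P \<subseteq> pverts (corona ?P H)"
    by (auto simp: corona_def)
  ultimately have "card (pverts ?P) \<le> card (pverts (corona ?P H))"
    by (metis (no_types, lifting) card_image card_mono inj_onI prod.inject)
  moreover have "card (push_label ` pverts (corona ?P H)) = card (pverts (corona ?P H))"
    using inj_push_label by (metis card_image inj_on_subset subset_UNIV)
  ultimately show ?case
    using Suc by (simp add: relabel_def)
qed

lemma equitably_colorable_corona_power:
  assumes "pair_graph G" "2 \<le> card (pverts G)" "equitably_colorable G 4" "3 \<le> 2 * k"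
  shows "equitably_colorable (corona_power G l (cycle_graph (2 * k))) 4"
proof (induction l)
  case 0
  show ?case
    using assms(1,3) by (simp add: equitably_colorable_relabel inj_def)
next
  case (Suc l)
  let ?P = "corona_power G l (cycle_graph (2 * k))"
  have H: "pair_graph (cycle_graph (2 * k))"
    using assms(4) by (rule pair_graph_cycle_graph)
  have P: "pair_graph ?P"
    using assms(1) H by (rule pair_graph_corona_power)
  have "2 \<le> card (pverts ?P)"
    using assms(2) card_pverts_corona_power[OF assms(1) H] by (rule order_trans)
  from equitably_colorable_corona_even_cycle[OF P this Suc assms(4)] show ?case
    using P H by (simp add: equitably_colorable_relabel pair_graph_corona inj_push_label)
qed

subsection \<open>Three colours do not suffice\<close>

text \<open>The vertices split into \<open>k\<close> adjacent pairs \<open>2 * j\<close>,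
  \<open>2 * j + 1\<close>, and each pair contains \<open>p\<close> exactly once.\<close>

lemma class_size_two_colored_even_cycle:
  assumes "proper_coloring (cycle_graph (2 * k)) m g"
    and "\<And>i. i < 2 * k \<Longrightarrow> g i \<in> {p, q}" "p \<noteq> q"
  shows "class_size (cycle_graph (2 * k)) g p = k"
proof -
  have "card {i. i < 2 * j \<and> g i = p} = j" if "j \<le> k" for j
    using that
  proof (induction j)
    case 0
    show ?case by simp
  next
    case (Suc j)
    have "(2 * j, 2 * j + 1) \<in> parcs (cycle_graph (2 * k))"
      using Suc.prems by (auto simp: cycle_graph_def)
    then have "g (2 * j) \<noteq> g (2 * j + 1)"
      using assms(1) unfolding proper_coloring_def by blast
    moreover have "g (2 * j) \<in> {p, q}" "g (2 * j + 1) \<in> {p, q}"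
      using Suc.prems assms(2) by auto
    \<comment> \<open>The member of the pair that has colour \<open>p\<close>.\<close>
    moreover define i where "i = (if g (2 * j) = p then 2 * j else 2 * j + 1)"
    ultimately have "(x = 2 * j \<or> x = 2 * j + 1) \<and> g x = p \<longleftrightarrow> x = i" for x
      by (cases "g (2 * j) = p") auto
    moreover have "x < 2 * Suc j \<longleftrightarrow> x < 2 * j \<or> x = 2 * j \<or> x = 2 * j + 1" for x
      by auto
    ultimately have "{x. x < 2 * Suc j \<and> g x = p} = insert i {x. x < 2 * j \<and> g x = p}"
      by blast
    moreover have "\<not> i < 2 * j"
      by (simp add: i_def)
    ultimately show ?case
      using Suc by simp
  qed
  then show ?thesis
    by (simp add: class_size_def cycle_graph_def)
qed

text \<open>A copy avoids the colour of its centre, so it has no vertex of colour \<open>c\<close>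
  if the centre has colour \<open>c\<close>, and exactly \<open>k\<close> otherwise. The equation is
  arranged to avoid subtraction on \<open>nat\<close>.\<close>

lemma class_size_corona_three_coloring:
  assumes "pair_graph G" "3 \<le> 2 * k"
    and "proper_coloring (corona G (cycle_graph (2 * k))) 3 f" "c < 3"
  shows "class_size (corona G (cycle_graph (2 * k))) f c + k * class_size G (\<lambda>v. f (v, None)) c
    = class_size G (\<lambda>v. f (v, None)) c + k * card (pverts G)"
proof -
  let ?H = "cycle_graph (2 * k)"
  have fin: "finite (pverts G)" "finite (pverts ?H)"
    using assms(1) pair_graph_cycle_graph[OF assms(2)] by (auto simp: pair_graph_iff)
  have copy: "class_size ?H (\<lambda>x. f (v, Some x)) c = (if f (v, None) = c then 0 else k)"
    if v: "v \<in> pverts G" for v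
  proof -
    have col: "proper_coloring ?H 3 (\<lambda>x. f (v, Some x))" "f (v, None) < 3"
        and ne: "\<And>x. x \<in> pverts ?H \<Longrightarrow> f (v, Some x) \<noteq> f (v, None)"
      using assms(3) v unfolding proper_coloring_corona proper_coloring_def[of G] by auto
    show ?thesis
    proof (cases "f (v, None) = c")
      case True
      then have "{x \<in> pverts ?H. f (v, Some x) = c} = {}"
        using ne by auto
      with True show ?thesis
        by (simp only: class_size_def card.empty if_True refl)
    next
      case False
      \<comment> \<open>The third colour: 0, 1 and 2 add up to 3.\<close>
      define q where "q = 3 - c - f (v, None)"
      have "f (v, Some i) \<in> {c, q}" if "i < 2 * k" for i
      proof -
        have "f (v, Some i) < 3" "f (v, Some i) \<noteq> f (v, None)"
          using that col(1) ne by (auto simp: proper_coloring_def cycle_graph_def)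
        then show ?thesis
          using False assms(4) col(2) by (auto simp: q_def)
      qed
      moreover have "c \<noteq> q"
        unfolding q_def using False assms(4) col(2) by arith
      ultimately show ?thesis
        using False class_size_two_colored_even_cycle[OF col(1)] by auto
    qed
  qed
  let ?A = "{v \<in> pverts G. f (v, None) = c}"
  have "(\<Sum>v\<in>pverts G. class_size ?H (\<lambda>x. f (v, Some x)) c) = (\<Sum>v\<in>pverts G - ?A. k)"
    using fin(1) copy by (intro sum.mono_neutral_cong_right) auto
  moreover have "card (pverts G) = card (pverts G - ?A) + card ?A"
    using fin(1) card_Diff_subset[of ?A "pverts G"] card_mono[of "pverts G" ?A] by auto
  ultimately show ?thesis
    unfolding class_size_corona[OF fin] class_size_def[of G]
    by (simp add: algebra_simps)
qed

text \<open>A surplus of \<open>d\<close> centres in one colour makes that colour's class in the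
  corona smaller by \<open>(k - 1) * d\<close>, which is at least 2 when \<open>d\<close> is
  positive.\<close>

lemma equal_classes_if_equitable_corona:
  assumes "pair_graph G" "3 \<le> k"
    and f: "proper_coloring (corona G (cycle_graph (2 * k))) 3 f"
    and eq: "\<And>i j. i < 3 \<Longrightarrow> j < 3 \<Longrightarrow> class_size (corona G (cycle_graph (2 * k))) f i
      \<le> class_size (corona G (cycle_graph (2 * k))) f j + 1"
    and "i < 3" "j < 3"
  shows "class_size G (\<lambda>v. f (v, None)) i = class_size G (\<lambda>v. f (v, None)) j"
proof -
  let ?s = "class_size (corona G (cycle_graph (2 * k))) f"
  let ?a = "class_size G (\<lambda>v. f (v, None))"
  have "?a j \<le> ?a i" if "i < 3" "j < 3" for i j
  proof (rule ccontr)
    assume "\<not> ?a j \<le> ?a i"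
    then obtain d where d: "?a j = ?a i + d" "1 \<le> d"
      by (intro that[of "?a j - ?a i"]) auto
    have "?s c + k * ?a c = ?a c + k * card (pverts G)" if "c < 3" for c
      using assms(1,2) f that by (intro class_size_corona_three_coloring) auto
    from this[OF that(1)] this[OF that(2)] have "?s j + k * d = ?s i + d"
      by (simp add: d(1) algebra_simps)
    moreover have "3 * d \<le> k * d"
      using assms(2) by simp
    ultimately show False
      using eq[OF that] d(2) by linarith
  qed
  then show ?thesis
    using assms(5,6) by (simp add: antisym)
qed

text \<open>Exact equality is the invariant of the descent: equal classes are in particular
  equitable, so the previous lemma makes them equal one layer further in. At the bottom,
  \<open>G\<close> is split into three classes of equal size.\<close>

lemma three_dvd_if_equal_classes:
  assumes "pair_graph G" "3 \<le> k"
    and "proper_coloring (corona_power G l (cycle_graph (2 * k))) 3 f"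
    and "\<And>i j. i < 3 \<Longrightarrow> j < 3 \<Longrightarrow> class_size (corona_power G l (cycle_graph (2 * k))) f i
      = class_size (corona_power G l (cycle_graph (2 * k))) f j"
  shows "3 dvd card (pverts G)"
  using assms(3,4)
proof (induction l arbitrary: f)
  case 0
  define g where "g = f \<circ> (\<lambda>v. (v, [] :: nat option list))"
  have inj: "inj (\<lambda>v :: 'a. (v, [] :: nat option list))"
    by (simp add: inj_def)
  have g: "proper_coloring G 3 g"
    using 0 by (simp add: proper_coloring_relabel g_def)
  have eq: "class_size G g i = class_size G g 0" if "i < 3" for i
    using 0(2)[of i 0] that by (simp add: class_size_relabel[OF inj] g_def)
  have "g ` pverts G \<subseteq> {..<3}"
    using g by (auto simp: proper_coloring_def)
  then have "card (pverts G) = (\<Sum>i<3. class_size G g i)"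
    using assms(1) sum.group[of "pverts G" "{..<3::nat}" g "\<lambda>_. 1 :: nat"]
    by (simp add: class_size_def pair_graph_iff)
  also have "\<dots> = (\<Sum>i<3::nat. class_size G g 0)"
    by (intro sum.cong refl eq) simp
  finally show ?case
    by simp
next
  case (Suc l)
  let ?P = "corona_power G l (cycle_graph (2 * k))"
  let ?g = "f \<circ> push_label"
  have P: "pair_graph ?P"
    using assms(1,2) by (intro pair_graph_corona_power pair_graph_cycle_graph) auto
  have g: "proper_coloring (corona ?P (cycle_graph (2 * k))) 3 ?g"
    using Suc.prems(1) by (simp add: proper_coloring_relabel)
  have "class_size (corona ?P (cycle_graph (2 * k))) ?g i
      \<le> class_size (corona ?P (cycle_graph (2 * k))) ?g j + 1" if "i < 3" "j < 3" for i j
    using Suc.prems(2)[OF that] by (simp add: class_size_relabel[OF inj_push_label])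
  note eq = equal_classes_if_equitable_corona[OF P assms(2) g this]
  have "proper_coloring ?P 3 (\<lambda>v. ?g (v, None))"
    using g by (simp only: proper_coloring_corona)
  from Suc.IH[OF this eq] show ?case .
qed

text \<open>The outermost corona upgrades equitability to exact equality, which starts the descent;
  hence the exponent \<open>Suc l\<close>.\<close>

lemma three_dvd_if_equitably_three_colorable:
  assumes "pair_graph G" "3 \<le> k"
    and "equitably_colorable (corona_power G (Suc l) (cycle_graph (2 * k))) 3"
  shows "3 dvd card (pverts G)"
proof -
  let ?P = "corona_power G l (cycle_graph (2 * k))"
  have H: "pair_graph (cycle_graph (2 * k))"
    using assms(2) by (intro pair_graph_cycle_graph) auto
  have P: "pair_graph ?P"
    using assms(1) H by (rule pair_graph_corona_power)
  have "equitably_colorable (corona ?P (cycle_graph (2 * k))) 3"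
    using assms(3) P H by (simp add: equitably_colorable_relabel pair_graph_corona inj_push_label)
  then obtain f where f: "proper_coloring (corona ?P (cycle_graph (2 * k))) 3 f"
      "\<And>i j. i < 3 \<Longrightarrow> j < 3 \<Longrightarrow> class_size (corona ?P (cycle_graph (2 * k))) f i
        \<le> class_size (corona ?P (cycle_graph (2 * k))) f j + 1"
    using P H by (auto simp: equitably_colorable_iff pair_graph_corona)
  have "proper_coloring ?P 3 (\<lambda>v. f (v, None))"
    using f(1) by (simp add: proper_coloring_corona)
  then show ?thesis
    using equal_classes_if_equitable_corona[OF P assms(2) f] assms(1,2)
    by (intro three_dvd_if_equal_classes[of G k l]) auto
qed

section \<open>Triangles and the final value\<close>

text \<open>A centre and the adjacent vertices \<open>0\<close> and \<open>1\<close> of its copy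
  form a triangle.\<close>

lemma equitably_colorable_corona_cycle_ge_3:
  assumes "pair_graph G" "pverts G \<noteq> {}" "3 \<le> n"
    and "equitably_colorable (corona G (cycle_graph n)) m"
  shows "3 \<le> m"
proof -
  have "pair_graph (corona G (cycle_graph n))"
    using assms(1,3) by (intro pair_graph_corona pair_graph_cycle_graph)
  then obtain f where f: "proper_coloring (corona G (cycle_graph n)) m f"
    using assms(4) by (auto simp: equitably_colorable_iff)
  obtain v where v: "v \<in> pverts G"
    using assms(2) by blast
  have H: "0 \<in> pverts (cycle_graph n)" "1 \<in> pverts (cycle_graph n)"
      "(0, 1) \<in> parcs (cycle_graph n)"
    using assms(3) by (auto simp: cycle_graph_def)
  have "f (v, None) < m" "proper_coloring (cycle_graph n) m (\<lambda>x. f (v, Some x))"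
      and ne: "f (v, Some 0) \<noteq> f (v, None)" "f (v, Some 1) \<noteq> f (v, None)"
    using f v H unfolding proper_coloring_corona proper_coloring_def[of G] by blast+
  moreover from this(2) have "f (v, Some 0) < m" "f (v, Some 1) < m" "f (v, Some 0) \<noteq> f (v, Some 1)"
    using H unfolding proper_coloring_def by blast+
  ultimately show ?thesis
    by linarith
qed

theorem theorem4:
  fixes G :: "'a pair_pre_digraph" and n k l :: nat
  assumes "pair_graph G"
    and "Digraph_Component.connected (with_proj G)"
    and "card (pverts G) = n"
    and "n \<ge> 2"
    and "equitably_colorable G 4"
    and "k \<ge> 3"
    and "l \<ge> 1"
    and "\<not> 3 dvd n"
  shows "equitable_chromatic_number (corona_power G l (cycle_graph (2 * k))) = 4"
  unfolding equitable_chromatic_number_def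
proof (rule Least_equality)
  show "equitably_colorable (corona_power G l (cycle_graph (2 * k))) 4"
    using assms by (intro equitably_colorable_corona_power) auto
next
  fix m assume m: "equitably_colorable (corona_power G l (cycle_graph (2 * k))) m"
  \<comment> \<open>Exposes the outermost corona, which supplies both the triangle and the start of
    the descent.\<close>
  obtain l' where l: "l = Suc l'"
    using assms(7) by (cases l) auto
  let ?P = "corona_power G l' (cycle_graph (2 * k))"
  have H: "pair_graph (cycle_graph (2 * k))"
    using assms(6) by (intro pair_graph_cycle_graph) auto
  have P: "pair_graph ?P"
    using assms(1) H by (rule pair_graph_corona_power)
  have ne: "pverts ?P \<noteq> {}"
    using card_pverts_corona_power[OF assms(1) H, of l'] assms(3,4) by auto
  have "equitably_colorable (corona ?P (cycle_graph (2 * k))) m"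
    using m P H by (simp add: l equitably_colorable_relabel pair_graph_corona inj_push_label)
  from equitably_colorable_corona_cycle_ge_3[OF P ne _ this] have "3 \<le> m"
    using assms(6) by linarith
  moreover have "m \<noteq> 3"
    using three_dvd_if_equitably_three_colorable[OF assms(1,6)] m assms(3,8) l by blast
  ultimately show "4 \<le> m"
    by linarith
qed

end
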